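(* Almost all tournaments are path extendable; that is, if $T_n$ denotes a tournament on $n$ labelled vertices chosen uniformly at random (each pair $\{u,v\}$ independently oriented as $uv$ or $vu$ with probability $1/2$ each), then the probability that $T_n$ is path extendable tends to $1$ as $n\to\infty$.
   Context: All paths are directed paths. A path $P$ in a digraph $D$ that is not hamiltonian is called extendable if there is a path $P'$ with the same initial and the same terminal vertex as $P$ and $V(P')=V(P)\cup\{w\}$ for some vertex $w\in V(D)\setminus V(P)$. A digraph is path extendable if every nonhamiltonian path of length at least $1$ in it is extendable. *)

theory Defs
  imports "Graph_Theory.Pair_Digraph" "Graph_Theory.Vertex_Walk" "HOL-Probability.Probability"
begin

definition hamiltonian_path :: "'a list \<Rightarrow> ('a, 'b) pre_digraph \<Rightarrow> bool" where
  "hamiltonian_path p G \<longleftrightarrow> vpath p G \<and> set p = verts G"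

definition extendable :: "'a list \<Rightarrow> ('a, 'b) pre_digraph \<Rightarrow> bool" where
  "extendable p G \<longleftrightarrow>
     (\<exists>q. vpath q G \<and> hd q = hd p \<and> last q = last p \<and>
          (\<exists>w \<in> verts G - set p. set q = set p \<union> {w}))"

definition path_extendable :: "('a, 'b) pre_digraph \<Rightarrow> bool" where
  "path_extendable G \<longleftrightarrow>
     (\<forall>p. vpath p G \<and> \<not> hamiltonian_path p G \<and> vwalk_length p \<ge> 1 \<longrightarrow> extendable p G)"

locale tournament = pair_digraph +
  assumes exactly_one_arc:
    "\<lbrakk>u \<in> pverts G; v \<in> pverts G; u \<noteq> v\<rbrakk> \<Longrightarrow> (u, v) \<in> parcs G \<longleftrightarrow> (v, u) \<notin> parcs G"

definition tournaments_on :: "'a set \<Rightarrow> 'a pair_pre_digraph set" where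
  "tournaments_on V = {T. tournament T \<and> pverts T = V}"

definition random_tournament :: "nat \<Rightarrow> nat pair_pre_digraph pmf" where
  "random_tournament n = pmf_of_set (tournaments_on {..<n})"

text \<open>
  The set underlying \<^const>\<open>random_tournament\<close> is finite and nonempty, as the use of
  \<^const>\<open>pmf_of_set\<close> requires, and the uniform distribution on it is the one in which every pair
  is oriented independently by a fair coin.
\<close>

definition orientation :: "nat \<Rightarrow> (nat \<times> nat \<Rightarrow> bool) \<Rightarrow> nat pair_pre_digraph" where
  "orientation n f = \<lparr>pverts = {..<n},
     parcs = {(u, v). u < v \<and> v < n \<and> f (u, v)} \<union> {(v, u). u < v \<and> v < n \<and> \<not> f (u, v)}\<rparr>"

lemma bij_betw_orientation:
  "bij_betw (orientation n) (PiE_dflt {(u, v). u < v \<and> v < n} False (\<lambda>_. UNIV))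
     (tournaments_on {..<n})"
  (is "bij_betw _ ?F _")
proof (rule bij_betwI[where g = "\<lambda>T (u, v). u < v \<and> v < n \<and> (u, v) \<in> parcs T"])
  show "orientation n \<in> ?F \<rightarrow> tournaments_on {..<n}"
  proof
    fix f
    have "parcs (orientation n f) \<subseteq> {..<n} \<times> {..<n}"
      by (auto simp: orientation_def)
    then have "finite (parcs (orientation n f))"
      by (rule finite_subset) simp
    moreover have "(u, v) \<in> parcs (orientation n f) \<longleftrightarrow> (v, u) \<notin> parcs (orientation n f)"
      if "u < n" "v < n" "u \<noteq> v" for u v
      using that by (cases "u < v") (auto simp: orientation_def)
    ultimately have "tournament (orientation n f)"
      by unfold_locales (auto simp: orientation_def)
    then show "orientation n f \<in> tournaments_on {..<n}"
      by (simp add: tournaments_on_def orientation_def)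
  qed
next
  show "(\<lambda>T (u, v). u < v \<and> v < n \<and> (u, v) \<in> parcs T) \<in> tournaments_on {..<n} \<rightarrow> ?F"
    by (auto simp: PiE_dflt_def)
next
  fix f assume "f \<in> ?F"
  then show "(\<lambda>(u, v). u < v \<and> v < n \<and> (u, v) \<in> parcs (orientation n f)) = f"
    by (auto simp: PiE_dflt_def orientation_def fun_eq_iff)
next
  fix T assume "T \<in> tournaments_on {..<n}"
  then interpret tournament T
    by (simp add: tournaments_on_def)
  have V: "pverts T = {..<n}"
    using \<open>T \<in> tournaments_on {..<n}\<close> by (simp add: tournaments_on_def)
  let ?f = "\<lambda>(u, v). u < v \<and> v < n \<and> (u, v) \<in> parcs T"
  have mem: "(u, v) \<in> parcs (orientation n ?f) \<longleftrightarrow>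
      u < v \<and> v < n \<and> (u, v) \<in> parcs T \<or> v < u \<and> u < n \<and> (v, u) \<notin> parcs T" for u v
    unfolding orientation_def by auto
  have "(u, v) \<in> parcs (orientation n ?f) \<longleftrightarrow> (u, v) \<in> parcs T" for u v
  proof (cases "u < n \<and> v < n \<and> u \<noteq> v")
    case True
    then have "(u, v) \<in> parcs T \<longleftrightarrow> (v, u) \<notin> parcs T"
      using exactly_one_arc[of u v] V by blast
    with True show ?thesis
      unfolding mem by (metis linorder_neqE_nat order_less_asym)
  next
    case False
    have "(u, v) \<notin> parcs T"
      using False in_arcsD1[of u v] in_arcsD2[of u v] pair_no_loops[of "(u, v)"]
      unfolding V lessThan_iff fst_conv snd_conv by blast
    moreover have "\<not> (v < u \<and> u < n)"
      using False by linarith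
    ultimately show ?thesis
      unfolding mem by blast
  qed
  then have "parcs (orientation n ?f) = parcs T"
    by (simp add: set_eq_iff split_paired_all)
  moreover have "pverts (orientation n ?f) = pverts T"
    unfolding V by (simp add: orientation_def)
  ultimately show "orientation n ?f = T"
    by (intro pair_pre_digraph.equality) simp_all
qed

lemma finite_ordered_pairs: "finite {(u, v). u < v \<and> v < (n::nat)}"
  by (rule finite_subset[of _ "{..<n} \<times> {..<n}"]) auto

lemma finite_tournaments_on: "finite (tournaments_on {..<n::nat})"
  using bij_betw_finite[OF bij_betw_orientation[of n]]
    finite_PiE_dflt[OF finite_ordered_pairs[of n], of "\<lambda>_. UNIV :: bool set" False] by simp

lemma tournaments_on_nonempty: "tournaments_on {..<n::nat} \<noteq> {}"
proof -
  have "(\<lambda>_. False) \<in> PiE_dflt {(u, v). u < v \<and> v < n} False (\<lambda>_. UNIV)"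
    by (auto simp: PiE_dflt_def)
  then show ?thesis
    using bij_betw_orientation[of n] by (auto simp: bij_betw_def)
qed

lemma random_tournament_eq_coin_flips:
  "random_tournament n =
     map_pmf (orientation n) (Pi_pmf {(u, v). u < v \<and> v < n} False (\<lambda>_. bernoulli_pmf (1/2)))"
proof -
  let ?A = "{(u, v). u < v \<and> v < n}"
  let ?F = "PiE_dflt ?A False (\<lambda>_. UNIV :: bool set)"
  have "(\<lambda>_. False) \<in> ?F"
    by (auto simp: PiE_dflt_def)
  then have ne: "?F \<noteq> {}"
    by blast
  have fin: "finite ?F"
    using finite_ordered_pairs by (intro finite_PiE_dflt) auto
  have "Pi_pmf ?A False (\<lambda>_. bernoulli_pmf (1/2)) = pmf_of_set ?F"
    using Pi_pmf_of_set[OF finite_ordered_pairs[of n], of "\<lambda>_. UNIV" False]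
    by (simp add: bernoulli_pmf_half_conv_pmf_of_set)
  then show ?thesis
    using map_pmf_of_set_bij_betw[OF bij_betw_orientation[of n] ne fin]
    by (simp add: random_tournament_def)
qed

end

theory Submission
  imports Defs "HOL-Real_Asymp.Real_Asymp"
begin

text \<open>
  Put \<open>d = \<lfloor>sqrt n\<rfloor>\<close>. By union bounds, asymptotically almost surely (1) every ordered pair of distinct
  vertices \<open>u\<close>, \<open>v\<close> is joined by more than \<open>d\<close> paths of length 2, and (2) for every sequence of \<open>d\<close>
  vertices and every disjoint set of \<open>d\<close> vertices, some vertex of the set can be inserted between two
  consecutive vertices of the sequence. For (2), a vertex that cannot be inserted is dominated exactly
  by the vertices of a final segment, so only \<open>d + 1\<close> of the \<open>2 ^ d\<close> adjacency patterns are possible.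
  Now (1) extends a path with at most \<open>d\<close> vertices at its first arc, (2) extends a path that has at
  least \<open>d\<close> vertices and misses at least \<open>d\<close>, and a path missing fewer than \<open>d\<close> vertices is rerouted
  through a missed vertex by means of (1).
\<close>

section \<open>Extending paths in tournaments\<close>

definition insertable :: "'a pair_pre_digraph \<Rightarrow> 'a \<Rightarrow> 'a list \<Rightarrow> bool" where
  "insertable G w xs \<longleftrightarrow>
     (\<exists>ys x y zs. xs = ys @ x # y # zs \<and> (x, w) \<in> parcs G \<and> (w, y) \<in> parcs G)"

definition middles :: "'a pair_pre_digraph \<Rightarrow> 'a \<Rightarrow> 'a \<Rightarrow> 'a set" where
  "middles G u v = {w. (u, w) \<in> parcs G \<and> (w, v) \<in> parcs G}"

text \<open>The inequality is strict so that a middle vertex survives outside any set of at most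
  \<open>d\<close> vertices.\<close>

definition many_middles :: "nat \<Rightarrow> 'a pair_pre_digraph \<Rightarrow> bool" where
  "many_middles d G \<longleftrightarrow>
     (\<forall>u \<in> pverts G. \<forall>v \<in> pverts G. u \<noteq> v \<longrightarrow> d < card (middles G u v))"

text \<open>\<open>ys\<close> is any list of distinct vertices, not only a path. For given
  \<open>ys\<close> and \<open>W\<close> only the arcs between \<open>set ys\<close> and
  \<open>W\<close> matter, and these are independent in a random tournament.\<close>

definition insertion_property :: "nat \<Rightarrow> 'a pair_pre_digraph \<Rightarrow> bool" where
  "insertion_property d G \<longleftrightarrow>
     (\<forall>ys W. distinct ys \<and> length ys = d \<and> set ys \<subseteq> pverts G \<and>
        W \<subseteq> pverts G - set ys \<and> card W = d \<longrightarrow> (\<exists>w \<in> W. insertable G w ys))"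

lemma insertable_append:
  assumes "insertable G w xs"
  shows "insertable G w (xs @ ys)"
  using assms unfolding insertable_def by (metis append.assoc append_Cons)

lemma insertable_Cons:
  assumes "insertable G w xs"
  shows "insertable G w (x # xs)"
proof -
  from assms obtain ys a b zs
    where "xs = ys @ a # b # zs" "(a, w) \<in> parcs G" "(w, b) \<in> parcs G"
    unfolding insertable_def by blast
  then have "x # xs = (x # ys) @ a # b # zs" by simp
  with \<open>(a, w) \<in> parcs G\<close> \<open>(w, b) \<in> parcs G\<close> show ?thesis
    unfolding insertable_def by blast
qed

lemma set_vwalk_arcs_subset_iff_successively:
  "set (vwalk_arcs p) \<subseteq> A \<longleftrightarrow> successively (\<lambda>u v. (u, v) \<in> A) p"
  by (induct p rule: vwalk_arcs.induct) auto

text \<open>Puts paths into a form in which spliced lists are checked by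
  \<open>successively_append_iff\<close>: only the arcs at the junctions are new.\<close>

lemma vpath_with_proj_iff:
  "vpath p (with_proj G) \<longleftrightarrow>
     p \<noteq> [] \<and> distinct p \<and> set p \<subseteq> pverts G \<and> successively (\<lambda>u v. (u, v) \<in> parcs G) p"
  unfolding vpath_def vwalk_def
  by (auto simp: set_vwalk_arcs_subset_iff_successively)

lemma extendable_if_insertable:
  assumes "vpath p (with_proj G)" "w \<in> pverts G - set p" "insertable G w p"
  shows "extendable p (with_proj G)"
proof -
  from assms(3) obtain ys x y zs
    where p: "p = ys @ x # y # zs" and arcs: "(x, w) \<in> parcs G" "(w, y) \<in> parcs G"
    unfolding insertable_def by blast
  let ?q = "ys @ x # w # y # zs"
  have "vpath ?q (with_proj G)"
    using assms(1,2) arcs unfolding vpath_with_proj_iff p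
    by (auto simp: successively_append_iff)
  moreover have "hd ?q = hd p" "last ?q = last p" "set ?q = set p \<union> {w}"
    by (auto simp: p hd_append)
  ultimately show ?thesis
    unfolding extendable_def using assms(2) by (metis with_proj_simps(1))
qed

context tournament
begin

lemma middle_avoiding:
  assumes "finite S" "card S < card (middles G u v)"
  obtains w where "w \<in> pverts G - S" "(u, w) \<in> parcs G" "(w, v) \<in> parcs G"
proof -
  have "\<not> middles G u v \<subseteq> S"
    using card_mono[OF assms(1), of "middles G u v"] assms(2) by linarith
  then show ?thesis
    using that by (auto simp: middles_def dest: in_arcsD2)
qed

text \<open>Once a vertex of \<open>xs\<close> dominates \<open>w\<close>, its successor must do so
  too, as otherwise \<open>w\<close> would fit between them. Hence the vertices dominated by
  \<open>w\<close> form an initial segment.\<close>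

lemma not_insertable_split:
  assumes "w \<in> pverts G" "set xs \<subseteq> pverts G - {w}" "\<not> insertable G w xs"
  shows "\<exists>as bs. xs = as @ bs \<and> (\<forall>a \<in> set as. (w, a) \<in> parcs G) \<and> (\<forall>b \<in> set bs. (b, w) \<in> parcs G)"
  using assms(2,3)
proof (induction xs)
  case Nil
  then show ?case by simp
next
  case (Cons x xs)
  then obtain as bs where split: "xs = as @ bs"
      "\<forall>a \<in> set as. (w, a) \<in> parcs G" "\<forall>b \<in> set bs. (b, w) \<in> parcs G"
    using insertable_Cons by fastforce
  show ?case
  proof (cases "(x, w) \<in> parcs G")
    case True
    have "as = []"
    proof (rule ccontr)
      assume "as \<noteq> []"
      then obtain a as' where "as = a # as'" by (cases as) auto
      then have "x # xs = [] @ x # a # (as' @ bs)" "(w, a) \<in> parcs G"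
        using split by auto
      with True Cons.prems(2) show False unfolding insertable_def by blast
    qed
    with True split have "x # xs = [] @ (x # bs)" "\<forall>b \<in> set (x # bs). (b, w) \<in> parcs G"
      by auto
    then show ?thesis by (metis empty_iff list.set(1))
  next
    case False
    then have "(w, x) \<in> parcs G"
      using exactly_one_arc[of w x] Cons.prems(1) assms(1) by auto
    with split have "x # xs = (x # as) @ bs" "\<forall>a \<in> set (x # as). (w, a) \<in> parcs G"
      by auto
    with split(3) show ?thesis by blast
  qed
qed

text \<open>If \<open>w\<close> cannot be inserted into \<open>p = as @ bs\<close>, where \<open>w\<close> dominates \<open>as\<close> and is dominated by
  \<open>bs\<close>, cut \<open>as = a1 @ a2\<close> and \<open>bs = b1 @ b2\<close> and reroute as \<open>a1 @ b1 @ [w] @ a2 @ b2\<close>.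
  The arcs into \<open>hd bs\<close> and out of \<open>last as\<close> needed for this are found among the 2-paths from \<open>w\<close> to
  \<open>hd bs\<close> and from \<open>last as\<close> to \<open>w\<close>, because few vertices lie outside \<open>p\<close>.\<close>

lemma long_path_extendable:
  assumes mm: "many_middles d G" and p: "vpath p (with_proj G)"
    and w: "w \<in> pverts G - set p" and long: "card (pverts G) - length p < d"
  shows "extendable p (with_proj G)"
proof (cases "insertable G w p")
  case True
  with p w show ?thesis by (rule extendable_if_insertable)
next
  case False
  have pp: "p \<noteq> []" "distinct p" "set p \<subseteq> pverts G" "successively (\<lambda>u v. (u, v) \<in> parcs G) p"
    using p by (auto simp: vpath_with_proj_iff)
  obtain as bs where split: "p = as @ bs"
      "\<forall>a \<in> set as. (w, a) \<in> parcs G" "\<forall>b \<in> set bs. (b, w) \<in> parcs G"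
    using not_insertable_split[of w p] False w pp(3) by auto
  \<comment> \<open>Fewer than \<open>d\<close> vertices lie off \<open>p\<close>, so one further
    vertex \<open>z\<close> can be forbidden and a middle vertex still remains.\<close>
  have card_outside: "card (insert z (pverts G - set p)) \<le> d" for z
  proof -
    have "card (pverts G - set p) < d"
      using long pp by (simp add: card_Diff_subset distinct_card)
    then show ?thesis
      by (simp add: card_insert_if)
  qed
  have fin: "finite (insert z (pverts G - set p))" for z by simp
  have asym: "(u, v) \<in> parcs G \<Longrightarrow> (v, u) \<notin> parcs G" for u v
    using exactly_one_arc[of u v] in_arcsD1 in_arcsD2 pair_no_loops by (metis fst_conv snd_conv)
  \<comment> \<open>A middle vertex of \<open>w\<close> and \<open>y\<close> that lies on
    \<open>p\<close> is dominated by \<open>w\<close>, hence belongs to \<open>as\<close>.\<close>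
  have from_w: "\<exists>v \<in> set as - {z}. (v, y) \<in> parcs G" if "y \<in> set p" for y z
  proof -
    have "card (insert z (pverts G - set p)) < card (middles G w y)"
      using card_outside[of z] mm that w pp(3) unfolding many_middles_def
      by (metis Diff_iff order_le_less_trans subset_iff)
    then obtain v where "v \<in> pverts G - insert z (pverts G - set p)" "(w, v) \<in> parcs G"
        "(v, y) \<in> parcs G"
      using middle_avoiding[OF fin] by blast
    then show ?thesis using split asym by auto
  qed
  have to_w: "\<exists>v \<in> set bs - {z}. (x, v) \<in> parcs G" if "x \<in> set p" for x z
  proof -
    have "card (insert z (pverts G - set p)) < card (middles G x w)"
      using card_outside[of z] mm that w pp(3) unfolding many_middles_def
      by (metis Diff_iff order_le_less_trans subset_iff)
    then obtain v where "v \<in> pverts G - insert z (pverts G - set p)" "(x, v) \<in> parcs G"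
        "(v, w) \<in> parcs G"
      using middle_avoiding[OF fin] by blast
    then show ?thesis using split asym by auto
  qed
  have ne: "as \<noteq> []" "bs \<noteq> []"
    using from_w[of "hd p"] to_w[of "hd p"] pp(1) by fastforce+
  \<comment> \<open>Forbidding \<open>last as\<close> makes the part \<open>a2\<close> of
    \<open>as\<close> behind \<open>v\<close> nonempty.\<close>
  obtain v where v: "v \<in> set as - {last as}" "(v, hd bs) \<in> parcs G"
    using from_w[of "hd bs" "last as"] ne split(1) by auto
  obtain a1' a2 where "as = a1' @ v # a2"
    using v(1) by (meson DiffD1 split_list)
  then obtain a1 where a1: "as = a1 @ a2" "a1 \<noteq> []" "last a1 = v" "a2 \<noteq> []"
    using v(1) by (metis Diff_iff append.assoc append_Cons append_Nil append_is_Nil_conv insertI1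
        last_snoc not_Cons_self2)
  \<comment> \<open>Forbidding \<open>hd bs\<close> makes the part \<open>b1\<close> of
    \<open>bs\<close> before \<open>u\<close> nonempty.\<close>
  obtain u where u: "u \<in> set bs - {hd bs}" "(last as, u) \<in> parcs G"
    using to_w[of "last as" "hd bs"] ne split(1) by auto
  obtain b1 b2' where b1: "bs = b1 @ u # b2'"
    using u(1) by (meson DiffD1 split_list)
  then have b1ne: "b1 \<noteq> []" using u(1) by auto
  define b2 where "b2 = u # b2'"
  have b2: "bs = b1 @ b2" "b2 \<noteq> []" "hd b2 = u" using b1 by (auto simp: b2_def)
  \<comment> \<open>Of the four junctions, the two at \<open>w\<close> come from the split of
    \<open>p\<close>, and the other two are the arcs found above.\<close>
  let ?q = "a1 @ b1 @ [w] @ a2 @ b2"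
  have "(last b1, w) \<in> parcs G" "(w, hd a2) \<in> parcs G"
    using split b2(1) a1 b1ne by auto
  moreover have "(v, hd b1) \<in> parcs G" "(last a2, u) \<in> parcs G"
    using u v a1 b2 b1ne by auto
  ultimately have "vpath ?q (with_proj G)"
    using pp w a1 b2 b1ne unfolding vpath_with_proj_iff split(1)
    by (auto simp: successively_append_iff successively_Cons)
  moreover have "hd ?q = hd p" "last ?q = last p" "set ?q = set p \<union> {w}"
    using a1 b2 b1ne by (auto simp: split(1))
  ultimately show ?thesis
    unfolding extendable_def using w by (metis with_proj_simps(1))
qed

lemma path_extendable_if_many_middles:
  assumes mm: "many_middles d G" and ins: "insertion_property d G"
  shows "path_extendable (with_proj G)"
  unfolding path_extendable_def
proof (intro allI impI)
  fix p assume asm: "vpath p (with_proj G) \<and> \<not> hamiltonian_path p (with_proj G) \<and> 1 \<le> vwalk_length p"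
  then have p: "vpath p (with_proj G)" and len: "2 \<le> length p" and "set p \<noteq> pverts G"
    by (auto simp: hamiltonian_path_def)
  have pp: "p \<noteq> []" "distinct p" "set p \<subseteq> pverts G" "successively (\<lambda>u v. (u, v) \<in> parcs G) p"
    using p by (auto simp: vpath_with_proj_iff)
  consider "length p \<le> d" | "d \<le> length p" "d \<le> card (pverts G) - length p"
    | "card (pverts G) - length p < d"
    by linarith
  then show "extendable p (with_proj G)"
  proof cases
    case 1
    obtain x y zs where xy: "p = x # y # zs"
      using len by (metis Suc_le_length_iff numeral_2_eq_2)
    \<comment> \<open>The middles of the first arc outnumber the vertices of \<open>p\<close>, so
      one of them lies off \<open>p\<close>.\<close>
    have "d < card (middles G x y)"
      using mm pp unfolding many_middles_def xy by auto
    then have "card (set p) < card (middles G x y)"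
      using 1 card_length[of p] by linarith
    then obtain w where "w \<in> pverts G - set p" "(x, w) \<in> parcs G" "(w, y) \<in> parcs G"
      using middle_avoiding[of "set p"] by blast
    moreover from this have "insertable G w p"
      unfolding insertable_def xy by (metis append_Nil)
    ultimately show ?thesis
      by (intro extendable_if_insertable[OF p])
  next
    case 2
    have "d \<le> card (pverts G - set p)"
      using 2 pp by (simp add: card_Diff_subset distinct_card)
    then obtain W where W: "W \<subseteq> pverts G - set p" "card W = d"
      by (meson obtain_subset_with_card_n)
    \<comment> \<open>Insertion into the first \<open>d\<close> vertices is insertion into
      \<open>p\<close>, and \<open>W\<close> was chosen off all of \<open>p\<close>.\<close>
    have "distinct (take d p)" "length (take d p) = d" "set (take d p) \<subseteq> pverts G"
        "W \<subseteq> pverts G - set (take d p)"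
      using W pp 2 set_take_subset[of d p] by auto
    then obtain w where "w \<in> W" "insertable G w (take d p)"
      using ins W(2) unfolding insertion_property_def by blast
    then have "insertable G w p"
      using insertable_append[of G w "take d p" "drop d p"] by simp
    moreover have "w \<in> pverts G - set p"
      using W(1) \<open>w \<in> W\<close> by blast
    ultimately show ?thesis
      by (intro extendable_if_insertable[OF p])
  next
    case 3
    obtain w where "w \<in> pverts G - set p"
      using \<open>set p \<noteq> pverts G\<close> pp(3) by blast
    then show ?thesis
      by (rule long_path_extendable[OF mm p _ 3])
  qed
qed

end

section \<open>Random tournaments\<close>

lemma arc_orientation_iff:
  "(u, v) \<in> parcs (orientation n f) \<longleftrightarrow>
     u < v \<and> v < n \<and> f (u, v) \<or> v < u \<and> u < n \<and> \<not> f (v, u)"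
  by (auto simp: orientation_def)

section \<open>Union bound and independence of arcs\<close>

lemma prob_Union_le:
  assumes "finite I" "\<And>i. i \<in> I \<Longrightarrow> measure_pmf.prob M (A i) \<le> c"
  shows "measure_pmf.prob M (\<Union>i\<in>I. A i) \<le> real (card I) * c"
proof -
  have "measure_pmf.prob M (\<Union>i\<in>I. A i) \<le> (\<Sum>i\<in>I. measure_pmf.prob M (A i))"
    using assms(1) by (intro measure_pmf.finite_measure_subadditive_finite) auto
  also have "\<dots> \<le> (\<Sum>i\<in>I. c)"
    using assms(2) by (intro sum_mono)
  finally show ?thesis by simp
qed

text \<open>By independence the probability is a product over \<open>A\<close>, with a factor 1/2 at
  each prescribed coin and 1 at the others.\<close>

lemma prob_fair_coins:
  assumes "finite A" "S \<subseteq> A"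
  shows "measure_pmf.prob (Pi_pmf A False (\<lambda>_. bernoulli_pmf (1/2))) {f. \<forall>e \<in> S. f e = b e}
           = (1/2) ^ card S"
proof -
  have "{f. \<forall>e \<in> S. f e = b e} = Pi A (\<lambda>e. if e \<in> S then {b e} else UNIV)"
    using assms(2) by (auto simp: Pi_iff split: if_splits)
  then have "measure_pmf.prob (Pi_pmf A False (\<lambda>_. bernoulli_pmf (1/2))) {f. \<forall>e \<in> S. f e = b e}
      = (\<Prod>e\<in>A. measure_pmf.prob (bernoulli_pmf (1/2)) (if e \<in> S then {b e} else UNIV))"
    using measure_Pi_pmf_Pi[OF assms(1)] by simp
  also have "\<dots> = (\<Prod>e\<in>A. if e \<in> S then 1/2 else 1)"
  proof (intro prod.cong refl)
    fix e
    show "measure_pmf.prob (bernoulli_pmf (1/2)) (if e \<in> S then {b e} else UNIV)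
        = (if e \<in> S then 1/2 else 1)"
      by (cases "b e") (auto simp: measure_pmf_single)
  qed
  also have "\<dots> = (1/2) ^ card S"
    using assms by (simp add: prod.If_cases Int_absorb1)
  finally show ?thesis .
qed

text \<open>As \<open>X\<close> and \<open>W\<close> are disjoint, the pairs in
  \<open>X \<times> W\<close> use \<open>card X * card W\<close> different coins, and the event
  prescribes each of them.\<close>

lemma prob_prescribed_arcs:
  assumes "X \<subseteq> {..<n}" "W \<subseteq> {..<n}" "X \<inter> W = {}"
  shows "measure_pmf.prob (random_tournament n)
           {T. \<forall>w \<in> W. {x \<in> X. (x, w) \<in> parcs T} = N w \<inter> X} = (1/2) ^ (card X * card W)"
proof -
  let ?A = "{(u, v). u < v \<and> v < n}"
  \<comment> \<open>Coins are indexed with the smaller vertex first; \<open>?e\<close> finds the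
    coin of a pair and \<open>?b\<close> its required value. True means an arc from the smaller to
    the larger vertex, so the condition is negated if the smaller one lies in
    \<open>W\<close>.\<close>
  let ?e = "\<lambda>(x, w). (min x w, max x w)"
  let ?b = "\<lambda>(u, v). if u \<in> X then u \<in> N v else v \<notin> N u"
  have inj: "inj_on ?e (X \<times> W)"
    using assms(3) by (auto simp: inj_on_def min_def max_def split: if_splits)
  have sub: "?e ` (X \<times> W) \<subseteq> ?A"
  proof (intro image_subsetI)
    fix xw assume "xw \<in> X \<times> W"
    then obtain x w where "xw = (x, w)" "x \<in> X" "w \<in> W"
      by blast
    moreover from this have "x < n" "w < n" "x \<noteq> w"
      using assms by blast+
    ultimately show "?e xw \<in> ?A" by auto
  qed
  have "(\<forall>w \<in> W. {x \<in> X. (x, w) \<in> parcs (orientation n f)} = N w \<inter> X) \<longleftrightarrow>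
      (\<forall>e \<in> ?e ` (X \<times> W). f e = ?b e)" for f
  proof -
    have eq: "((x, w) \<in> parcs (orientation n f) \<longleftrightarrow> x \<in> N w) \<longleftrightarrow> f (?e (x, w)) = ?b (?e (x, w))"
      if "x \<in> X" "w \<in> W" for x w
    proof -
      have "x < n" "w < n" "w \<notin> X" "x \<noteq> w" using assms that by blast+
      then show ?thesis
        using that unfolding arc_orientation_iff by (cases "x < w") auto
    qed
    have "(\<forall>w \<in> W. {x \<in> X. (x, w) \<in> parcs (orientation n f)} = N w \<inter> X) \<longleftrightarrow>
        (\<forall>x \<in> X. \<forall>w \<in> W. (x, w) \<in> parcs (orientation n f) \<longleftrightarrow> x \<in> N w)"
      by blast
    also have "\<dots> \<longleftrightarrow> (\<forall>x \<in> X. \<forall>w \<in> W. f (?e (x, w)) = ?b (?e (x, w)))"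
      by (intro ball_cong refl eq)
    also have "\<dots> \<longleftrightarrow> (\<forall>e \<in> ?e ` (X \<times> W). f e = ?b e)"
      by auto
    finally show ?thesis .
  qed
  then have "measure_pmf.prob (random_tournament n)
           {T. \<forall>w \<in> W. {x \<in> X. (x, w) \<in> parcs T} = N w \<inter> X}
      = measure_pmf.prob (Pi_pmf ?A False (\<lambda>_. bernoulli_pmf (1/2)))
          {f. \<forall>e \<in> ?e ` (X \<times> W). f e = ?b e}"
    by (simp add: random_tournament_eq_coin_flips vimage_def)
  also have "\<dots> = (1/2) ^ card (?e ` (X \<times> W))"
    by (rule prob_fair_coins[OF finite_ordered_pairs sub])
  also have "card (?e ` (X \<times> W)) = card X * card W"
    by (simp only: card_image[OF inj] card_cartesian_product)
  finally show ?thesis .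
qed

text \<open>A union bound over the \<open>card F ^ card W\<close> ways to assign to each vertex of
  \<open>W\<close> its in-neighbours in \<open>X\<close>. Both properties fail through events of
  this shape.\<close>

lemma prob_in_neighbours_le:
  assumes "X \<subseteq> {..<n}" "W \<subseteq> {..<n}" "X \<inter> W = {}" "F \<subseteq> Pow X"
  shows "measure_pmf.prob (random_tournament n) {T. \<forall>w \<in> W. {x \<in> X. (x, w) \<in> parcs T} \<in> F}
           \<le> (real (card F) / 2 ^ card X) ^ card W"
proof -
  have finX: "finite X" and finW: "finite W"
    using assms(1,2) by (auto intro: finite_subset)
  then have finF: "finite F"
    using assms(4) by (auto intro: finite_subset)
  let ?E = "\<lambda>N. {T. \<forall>w \<in> W. {x \<in> X. (x, w) \<in> parcs T} = N w \<inter> X}"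
  let ?I = "PiE W (\<lambda>_. F)"
  have "{T. \<forall>w \<in> W. {x \<in> X. (x, w) \<in> parcs T} \<in> F} \<subseteq> (\<Union>N \<in> ?I. ?E N)"
  proof
    fix T assume "T \<in> {T. \<forall>w \<in> W. {x \<in> X. (x, w) \<in> parcs T} \<in> F}"
    then have "(\<lambda>w \<in> W. {x \<in> X. (x, w) \<in> parcs T}) \<in> ?I"
        "T \<in> ?E (\<lambda>w \<in> W. {x \<in> X. (x, w) \<in> parcs T})"
      by auto
    then show "T \<in> (\<Union>N \<in> ?I. ?E N)" by blast
  qed
  then have "measure_pmf.prob (random_tournament n) {T. \<forall>w \<in> W. {x \<in> X. (x, w) \<in> parcs T} \<in> F}
      \<le> measure_pmf.prob (random_tournament n) (\<Union>N \<in> ?I. ?E N)"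
    by (intro measure_pmf.finite_measure_mono) auto
  also have "\<dots> \<le> real (card ?I) * (1/2) ^ (card X * card W)"
    using finW finF
    by (intro prob_Union_le) (auto intro: finite_PiE simp: prob_prescribed_arcs[OF assms(1-3)])
  also have "card ?I = card F ^ card W"
    using finW by (simp add: card_PiE)
  also have "real (card F ^ card W) * (1/2) ^ (card X * card W) = (real (card F) / 2 ^ card X) ^ card W"
    by (simp add: power_divide power_mult)
  finally show ?thesis .
qed

lemma card_subsets_le_power:
  assumes "finite A"
  shows "card {B. B \<subseteq> A \<and> card B = k} \<le> card A ^ k"
  using n_subsets[OF assms, of k] binomial_le_pow[of k "card A"]
  by (cases "k \<le> card A") (simp_all add: binomial_eq_0)

lemma set_pmf_random_tournament:
  assumes "T \<in> set_pmf (random_tournament n)"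
  shows "tournament T" "pverts T = {..<n}"
  using assms finite_tournaments_on[of n] tournaments_on_nonempty[of n]
  by (auto simp: random_tournament_def tournaments_on_def)

section \<open>Failure probabilities of the two properties\<close>

text \<open>If \<open>u\<close> and \<open>v\<close> have at most \<open>d\<close> middles, these
  lie in some \<open>S\<close> of size \<open>d\<close>, and every other vertex \<open>w\<close>
  shows one of only three of the four adjacency patterns to \<open>u\<close> and \<open>v\<close>.
  There are at most \<open>n ^ 2 * n ^ d\<close> choices of \<open>u\<close>, \<open>v\<close> and
  \<open>S\<close>.\<close>

lemma prob_not_many_middles_le:
  assumes "d \<le> n"
  shows "measure_pmf.prob (random_tournament n) {T. \<not> many_middles d T}
           \<le> real (n ^ (d + 2)) * (3/4) ^ (n - d - 2)"
proof -
  let ?M = "random_tournament n"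
  let ?I = "{(u, v). u < n \<and> v < n \<and> u \<noteq> v} \<times> {S. S \<subseteq> {..<n} \<and> card S = d}"
  \<comment> \<open>A middle has exactly \<open>u\<close> as in-neighbour in \<open>{u, v}\<close>,
    hence the removed pattern.\<close>
  let ?E = "\<lambda>((u, v), S). {T. \<forall>w \<in> {..<n} - S - {u, v}.
               {x \<in> {u, v}. (x, w) \<in> parcs T} \<in> Pow {u, v} - {{u}}}"
  have fin: "finite ?I"
    by (intro finite_cartesian_product finite_subset[of "{(u, v). u < n \<and> v < n \<and> u \<noteq> v}" "{..<n} \<times> {..<n}"])
      auto
  have "card ?I = card {(u, v). u < n \<and> v < n \<and> u \<noteq> v} * card {S. S \<subseteq> {..<n} \<and> card S = d}"
    by (rule card_cartesian_product)
  also have "\<dots> \<le> card ({..<n} \<times> {..<n}) * n ^ d"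
    using card_subsets_le_power[of "{..<n}" d] by (intro mult_le_mono card_mono) auto
  finally have cardI: "card ?I \<le> n ^ (d + 2)"
    by (simp add: power_add power2_eq_square mult_ac)
  have "measure_pmf.prob ?M {T. \<not> many_middles d T}
      = measure_pmf.prob ?M ({T. \<not> many_middles d T} \<inter> set_pmf ?M)"
    by (simp add: measure_Int_set_pmf)
  also have "\<dots> \<le> measure_pmf.prob ?M (\<Union>i \<in> ?I. ?E i)"
  proof (intro measure_pmf.finite_measure_mono subsetI)
    fix T assume T: "T \<in> {T. \<not> many_middles d T} \<inter> set_pmf ?M"
    then interpret tournament T using set_pmf_random_tournament by blast
    have V: "pverts T = {..<n}" using T set_pmf_random_tournament by blast
    have "\<not> many_middles d T" using T by blast
    then obtain u v where uv: "u < n" "v < n" "u \<noteq> v" "card (middles T u v) \<le> d"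
      unfolding many_middles_def V by (auto simp: not_less)
    have "middles T u v \<subseteq> {..<n}"
      using in_arcsD2 V by (auto simp: middles_def)
    then obtain S where S: "middles T u v \<subseteq> S" "S \<subseteq> {..<n}" "card S = d"
      using exists_subset_between[of "middles T u v" d "{..<n}"] uv(4) assms by auto
    have "{x \<in> {u, v}. (x, w) \<in> parcs T} \<noteq> {u}" if "w \<in> {..<n} - S - {u, v}" for w
    proof
      assume "{x \<in> {u, v}. (x, w) \<in> parcs T} = {u}"
      then have "(u, w) \<in> parcs T" "(v, w) \<notin> parcs T"
        using uv(3) by auto
      then have "w \<in> middles T u v"
        using exactly_one_arc[of v w] uv that V by (auto simp: middles_def)
      with S(1) that show False by blast
    qed
    then have "T \<in> ?E ((u, v), S)" by auto
    moreover have "((u, v), S) \<in> ?I" using uv S by auto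
    ultimately show "T \<in> (\<Union>i \<in> ?I. ?E i)" by blast
  qed simp
  also have "\<dots> \<le> real (card ?I) * (3/4) ^ (n - d - 2)"
  proof (rule prob_Union_le[OF fin])
    fix i assume "i \<in> ?I"
    then obtain u v S where i: "i = ((u, v), S)" "u < n" "v < n" "u \<noteq> v" "S \<subseteq> {..<n}" "card S = d"
      by auto
    let ?W = "{..<n} - S - {u, v}"
    have "card (Pow {u, v} - {{u}}) = 3"
      using i(4) by (simp add: card_Diff_subset card_Pow)
    then have "measure_pmf.prob ?M (?E i) \<le> (3/4) ^ card ?W"
      using prob_in_neighbours_le[of "{u, v}" n ?W "Pow {u, v} - {{u}}"] i by auto
    \<comment> \<open>\<open>u\<close> or \<open>v\<close> may lie in \<open>S\<close>, so
      \<open>?W\<close> can be larger than \<open>n - d - 2\<close>; as the base is below 1, this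
      only helps.\<close>
    also have "\<dots> \<le> (3/4) ^ (n - d - 2)"
    proof (rule power_decreasing)
      have "n - d = card ({..<n} - S)"
        using i by (simp add: card_Diff_subset finite_subset[OF i(5)])
      also have "\<dots> - 2 \<le> card ?W"
        using diff_card_le_card_Diff[of "{u, v}" "{..<n} - S"] i(4) by simp
      finally show "n - d - 2 \<le> card ?W" by simp
    qed auto
    finally show "measure_pmf.prob ?M (?E i) \<le> (3/4) ^ (n - d - 2)" .
  qed
  also have "\<dots> \<le> real (n ^ (d + 2)) * (3/4) ^ (n - d - 2)"
    using cardI by (intro mult_right_mono of_nat_mono) auto
  finally show ?thesis .
qed

text \<open>Each of the \<open>d\<close> vertices of a set must show one of at most
  \<open>d + 1\<close> of the \<open>2 ^ d\<close> patterns, and there are at most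
  \<open>n ^ d\<close> lists and \<open>n ^ d\<close> sets.\<close>

lemma prob_not_insertion_property_le:
  "measure_pmf.prob (random_tournament n) {T. \<not> insertion_property d T}
     \<le> (real n ^ 2 * (real d + 1) / 2 ^ d) ^ d"
proof -
  let ?M = "random_tournament n"
  let ?I = "{(ys, W). distinct ys \<and> length ys = d \<and> set ys \<subseteq> {..<n} \<and>
              W \<subseteq> {..<n} - set ys \<and> card W = d}"
  \<comment> \<open>\<open>j\<close> is the length of the initial segment dominated by
    \<open>w\<close>; both 0 and \<open>d\<close> are possible, which gives \<open>d + 1\<close>
    values.\<close>
  let ?F = "\<lambda>ys :: nat list. (\<lambda>j. set (drop j ys)) ` {..d}"
  let ?E = "\<lambda>(ys, W). {T. \<forall>w \<in> W. {x \<in> set ys. (x, w) \<in> parcs T} \<in> ?F ys}"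
  let ?J = "{ys. set ys \<subseteq> {..<n} \<and> length ys = d} \<times> {S. S \<subseteq> {..<n} \<and> card S = d}"
  have IJ: "?I \<subseteq> ?J" by auto
  have finJ: "finite ?J"
    by (intro finite_cartesian_product finite_lists_length_eq) auto
  have "card ?I \<le> card ?J"
    by (rule card_mono[OF finJ IJ])
  also have "\<dots> = n ^ d * card {S. S \<subseteq> {..<n} \<and> card S = d}"
    by (simp add: card_cartesian_product card_lists_length_eq)
  also have "\<dots> \<le> n ^ d * n ^ d"
    using card_subsets_le_power[of "{..<n}" d] by (intro mult_le_mono) auto
  finally have cardI: "card ?I \<le> (n ^ 2) ^ d"
    by (simp add: power_mult_distrib power2_eq_square)
  have "measure_pmf.prob ?M {T. \<not> insertion_property d T}
      = measure_pmf.prob ?M ({T. \<not> insertion_property d T} \<inter> set_pmf ?M)"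
    by (simp add: measure_Int_set_pmf)
  also have "\<dots> \<le> measure_pmf.prob ?M (\<Union>i \<in> ?I. ?E i)"
  proof (intro measure_pmf.finite_measure_mono subsetI)
    fix T assume T: "T \<in> {T. \<not> insertion_property d T} \<inter> set_pmf ?M"
    then interpret tournament T using set_pmf_random_tournament by blast
    have V: "pverts T = {..<n}" using T set_pmf_random_tournament by blast
    have "\<not> insertion_property d T" using T by blast
    then obtain ys W where ysW: "(ys, W) \<in> ?I" and no: "\<forall>w \<in> W. \<not> insertable T w ys"
      unfolding insertion_property_def V by blast
    have "{x \<in> set ys. (x, w) \<in> parcs T} \<in> ?F ys" if w: "w \<in> W" for w
    proof -
      have "w \<in> pverts T" "set ys \<subseteq> pverts T - {w}" using ysW w V by auto
      then obtain as bs where split: "ys = as @ bs"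
          "\<forall>a \<in> set as. (w, a) \<in> parcs T" "\<forall>b \<in> set bs. (b, w) \<in> parcs T"
        using not_insertable_split[of w ys] no w by blast
      have "(a, w) \<notin> parcs T" if "a \<in> set as" for a
        using split(1,2) that exactly_one_arc[of w a] \<open>w \<in> pverts T\<close> \<open>set ys \<subseteq> pverts T - {w}\<close>
        by auto
      then have "{x \<in> set ys. (x, w) \<in> parcs T} = set (drop (length as) ys)"
        using split by auto
      moreover have "length as \<le> d" using split(1) ysW by auto
      ultimately show ?thesis by blast
    qed
    then have "T \<in> ?E (ys, W)" by simp
    with ysW show "T \<in> (\<Union>i \<in> ?I. ?E i)" by blast
  qed simp
  also have "\<dots> \<le> real (card ?I) * ((real d + 1) / 2 ^ d) ^ d"
  proof (rule prob_Union_le)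
    show "finite ?I" using finJ IJ by (rule rev_finite_subset)
  next
    fix i assume "i \<in> ?I"
    then obtain ys W where i: "i = (ys, W)" "distinct ys" "length ys = d" "set ys \<subseteq> {..<n}"
        "W \<subseteq> {..<n} - set ys" "card W = d"
      by auto
    have "?F ys \<subseteq> Pow (set ys)" using set_drop_subset by fast
    then have "measure_pmf.prob ?M (?E i) \<le> (real (card (?F ys)) / 2 ^ d) ^ d"
      using prob_in_neighbours_le[of "set ys" n W "?F ys"] i distinct_card[of ys] by auto
    also have "\<dots> \<le> ((real d + 1) / 2 ^ d) ^ d"
      using card_image_le[of "{..d}" "\<lambda>j. set (drop j ys)"]
      by (intro power_mono divide_right_mono) auto
    finally show "measure_pmf.prob ?M (?E i) \<le> ((real d + 1) / 2 ^ d) ^ d" .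
  qed
  also have "\<dots> \<le> real ((n ^ 2) ^ d) * ((real d + 1) / 2 ^ d) ^ d"
    using cardI by (intro mult_right_mono of_nat_mono) auto
  also have "\<dots> = (real n ^ 2 * (real d + 1) / 2 ^ d) ^ d"
    by (simp add: power_mult_distrib power_divide)
  finally show ?thesis .
qed

text \<open>A tournament that is not path extendable violates one of the two properties. The
  parameter \<open>d\<close> stays free until the limit is taken.\<close>

lemma prob_path_extendable_ge:
  assumes "d \<le> n"
  shows "1 - real (n ^ (d + 2)) * (3/4) ^ (n - d - 2) - (real n ^ 2 * (real d + 1) / 2 ^ d) ^ d
           \<le> measure_pmf.prob (random_tournament n) {T. path_extendable (with_proj T)}"
proof -
  let ?M = "random_tournament n"
  let ?B1 = "{T. \<not> many_middles d T}" and ?B2 = "{T. \<not> insertion_property d T}"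
  let ?P = "{T. path_extendable (with_proj T)}"
  have "1 - measure_pmf.prob ?M ?P = measure_pmf.prob ?M (- ?P)"
    using measure_pmf.prob_compl[of ?P ?M] by (simp add: Compl_eq_Diff_UNIV)
  also have "\<dots> = measure_pmf.prob ?M (- ?P \<inter> set_pmf ?M)"
    by (simp add: measure_Int_set_pmf)
  also have "\<dots> \<le> measure_pmf.prob ?M (?B1 \<union> ?B2)"
    using tournament.path_extendable_if_many_middles set_pmf_random_tournament(1)
    by (intro measure_pmf.finite_measure_mono) auto
  also have "\<dots> \<le> measure_pmf.prob ?M ?B1 + measure_pmf.prob ?M ?B2"
    by (rule measure_Un_le) auto
  finally show ?thesis
    using prob_not_many_middles_le[OF assms] prob_not_insertion_property_le[of n d] by linarith
qed

section \<open>Asymptotics of the error terms\<close>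

text \<open>The first factor is \<open>exp (O(sqrt n * ln n))\<close>, while the second decays
  exponentially in \<open>n\<close>. Real exponents replace the rounded ones so that
  \<open>real_asymp\<close> applies.\<close>

lemma tendsto_many_middles_bound:
  fixes d :: "nat \<Rightarrow> nat"
  defines "d \<equiv> \<lambda>n. nat \<lfloor>sqrt (real n)\<rfloor>"
  shows "(\<lambda>n. real (n ^ (d n + 2)) * (3/4) ^ (n - d n - 2)) \<longlonglongrightarrow> 0"
proof (rule tendsto_sandwich[OF _ _ tendsto_const])
  show "\<forall>\<^sub>F n in sequentially. 0 \<le> real (n ^ (d n + 2)) * (3/4) ^ (n - d n - 2)"
    by simp
  show "\<forall>\<^sub>F n in sequentially. real (n ^ (d n + 2)) * (3/4) ^ (n - d n - 2)
      \<le> real n powr (sqrt n + 2) * (3/4) powr (real n - sqrt n - 2)"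
    using eventually_ge_at_top[of 1]
  proof eventually_elim
    case (elim n)
    have d: "real (d n) \<le> sqrt n" unfolding d_def by simp
    have "real (n ^ (d n + 2)) = real n powr real (d n + 2)"
      using elim by (simp only: powr_realpow of_nat_power of_nat_0_less_iff)
    also have "\<dots> \<le> real n powr (sqrt n + 2)"
      using d elim by (intro powr_mono) auto
    finally have 1: "real (n ^ (d n + 2)) \<le> real n powr (sqrt n + 2)" .
    have "(3/4 :: real) ^ (n - d n - 2) = (3/4) powr real (n - d n - 2)"
      by (simp add: powr_realpow)
    \<comment> \<open>The truncated difference is at least the real one, and the base is below
      1.\<close>
    also have "\<dots> \<le> (3/4) powr (real n - sqrt n - 2)"
      using d by (intro powr_mono') auto
    finally show ?case
      using 1 by (intro mult_mono) auto
  qed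
  show "(\<lambda>n. real n powr (sqrt n + 2) * (3/4) powr (real n - sqrt n - 2)) \<longlonglongrightarrow> 0"
    by real_asymp
qed

text \<open>\<open>2 ^ d\<close> outgrows every polynomial in \<open>n\<close>, so the base tends to
  0; once it is at most 1, its power with positive exponent is at most the base itself.\<close>

lemma tendsto_insertion_bound:
  fixes d :: "nat \<Rightarrow> nat"
  defines "d \<equiv> \<lambda>n. nat \<lfloor>sqrt (real n)\<rfloor>"
  shows "(\<lambda>n. (real n ^ 2 * (real (d n) + 1) / 2 ^ d n) ^ d n) \<longlonglongrightarrow> 0"
proof -
  \<comment> \<open>Rounding down loses less than 1, whence the exponent \<open>sqrt n - 1\<close>
    in the denominator.\<close>
  let ?x = "\<lambda>n. real n ^ 2 * (sqrt n + 1) / 2 powr (sqrt n - 1)"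
  have lim: "?x \<longlonglongrightarrow> 0" by real_asymp
  then have "\<forall>\<^sub>F n in sequentially. ?x n < 1"
    by (rule order_tendstoD) simp
  then have "\<forall>\<^sub>F n in sequentially. (real n ^ 2 * (real (d n) + 1) / 2 ^ d n) ^ d n \<le> ?x n"
    using eventually_ge_at_top[of 1]
  proof eventually_elim
    case (elim n)
    have d: "real (d n) \<le> sqrt n" "sqrt n - 1 \<le> real (d n)" "1 \<le> d n"
      using elim(2) unfolding d_def by (auto simp: le_nat_iff le_floor_iff)
    let ?y = "real n ^ 2 * (real (d n) + 1) / 2 ^ d n"
    have "2 powr (sqrt n - 1) \<le> 2 powr real (d n)"
      using d by (intro powr_mono) auto
    then have "2 powr (sqrt n - 1) \<le> 2 ^ d n"
      by (simp add: powr_realpow)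
    then have yx: "?y \<le> ?x n"
      using d(1) by (intro frac_le mult_left_mono) auto
    have "?y \<le> 1"
      using yx elim(1) by linarith
    then have "?y ^ d n \<le> ?y ^ 1"
      using d(3) by (intro power_decreasing) auto
    with yx show ?case by simp
  qed
  then show ?thesis
    by (intro tendsto_sandwich[OF _ _ tendsto_const lim]) auto
qed

theorem theorem11:
  shows "(\<lambda>n. measure_pmf.prob (random_tournament n) {T. path_extendable (with_proj T)})
           \<longlonglongrightarrow> 1"
proof (rule tendsto_sandwich[OF _ _ _ tendsto_const])
  \<comment> \<open>The order \<open>sqrt n\<close> keeps \<open>d * ln n\<close> small against
    \<open>n\<close>, while \<open>2 ^ d\<close> still beats \<open>n ^ 2 * (d + 1)\<close>.\<close>
  let ?d = "\<lambda>n. nat \<lfloor>sqrt (real n)\<rfloor>"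
  let ?L = "\<lambda>n. 1 - real (n ^ (?d n + 2)) * (3/4) ^ (n - ?d n - 2)
                 - (real n ^ 2 * (real (?d n) + 1) / 2 ^ ?d n) ^ ?d n"
  have "?d n \<le> n" for n
  proof -
    have "sqrt n \<le> n"
      by (rule real_le_lsqrt) (auto simp: power2_eq_square simp flip: of_nat_mult)
    then show ?thesis by linarith
  qed
  then show "\<forall>\<^sub>F n in sequentially. ?L n \<le>
      measure_pmf.prob (random_tournament n) {T. path_extendable (with_proj T)}"
    by (intro always_eventually allI prob_path_extendable_ge)
  show "\<forall>\<^sub>F n in sequentially.
      measure_pmf.prob (random_tournament n) {T. path_extendable (with_proj T)} \<le> 1"
    by simp
  show "?L \<longlonglongrightarrow> 1"
    using tendsto_diff[OF tendsto_diff[OF tendsto_const[of 1] tendsto_many_middles_bound]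
        tendsto_insertion_bound] by simp
qed

end
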